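(* Let $(X,\|\cdot\|)$ be a Banach space and $K\subset X$ a cone. Let $r_1,r_2,R$ be positive numbers with $r_i\le R$ ($i=1,2$) and $r_1\neq r_2$, and let $T:\overline{B}(0,R)\cap K\to K$ be a mapping (not necessarily continuous) such that $T(\overline{B}(0,R)\cap K)$ is relatively compact and $$\{x\}\cap\mathbb{T}x\subset\{Tx\}\quad\text{for all }x\in\overline{B}(0,R)\cap K,$$ where $\mathbb{T}$ is the closed--convex envelope of $T$. Suppose that (a) $\lambda x\notin\mathbb{T}x$ for all $x\in K$ with $\|x\|=r_1$ and all $\lambda\ge 1$; (b) there exists $w\in K$ with $\|w\|\ne 0$ such that $x\notin\mathbb{T}x+\lambda w$ for all $\lambda\ge 0$ and all $x\in K$ with $\|x\|=r_2$. Then $T$ has at least one fixed point $x\in K$ with $\min\{r_1,r_2\}<\|x\|<\max\{r_1,r_2\}$.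
   Context: A cone in a Banach space $X$ is a closed convex set $K$ such that $\lambda x\in K$ for all $x\in K$, $\lambda\ge 0$, and such that $x\in K$, $-x\in K$ imply $x=0$. For $D=\overline{B}(0,R)\cap K$ (with $\overline B(0,R)$ the closed ball of radius $R$ centered at $0$), the closed--convex envelope of $T:D\to K$ is the multivalued map $\mathbb{T}:D\to 2^K$, $\mathbb{T}x=\bigcap_{\varepsilon>0}\overline{\mathrm{co}}\,T\big(\overline{B}_\varepsilon(x)\cap D\big)$, where $\overline B_\varepsilon(x)$ is the closed ball of center $x$ and radius $\varepsilon$ and $\overline{\mathrm{co}}$ denotes closed convex hull. $\mathbb{T}x+\lambda w$ denotes the set $\{y+\lambda w: y\in\mathbb Tx\}$. *)

theory Defs
  imports "HOL-Analysis.Analysis"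
begin

definition is_cone :: "'a::banach set \<Rightarrow> bool" where
  "is_cone K \<longleftrightarrow> closed K \<and> convex K \<and>
     (\<forall>x\<in>K. \<forall>l::real. l \<ge> 0 \<longrightarrow> l *\<^sub>R x \<in> K) \<and>
     (\<forall>x. x \<in> K \<and> - x \<in> K \<longrightarrow> x = 0)"

definition cc_envelope :: "('a::banach \<Rightarrow> 'a) \<Rightarrow> 'a set \<Rightarrow> 'a \<Rightarrow> 'a set" where
  "cc_envelope T D x = (\<Inter>\<epsilon>\<in>{0<..}. closure (convex hull (T ` (cball x \<epsilon> \<inter> D))))"

end

theory Submission
  imports Defs "HOL-Homology.Simplices"
begin

text \<open>
  Let q = annulus_radius be r2 on [0, 2] and affine from r2 to r1 on [2, 3], let
  c(s) = max 1 s / q(s) and \<mu>(s) = max 0 (min 1 (2 - s)). On the part of the cone in the ball of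
  radius 3 consider the multivalued map y \<mapsto> c(|y|) (\<T>(y / c(|y|)) + \<Lambda> \<mu>(|y|) w); the
  truncation in c keeps y / c(|y|) continuous at 0. A fixed point y of this map followed by the
  radial retraction onto the ball gives, for u = y / c(|y|), some l \<ge> 1 with
  l u \<in> \<T>u + \<Lambda> \<mu>(|y|) w, and l = 1 unless |y| = 3. For large \<Lambda> the case |y| \<le> 1 is impossible
  because u is bounded by r2; (b) excludes 1 \<le> |y| \<le> 2, where |u| = r2, and (a) excludes
  |y| = 3, where |u| = r1. So 2 < |y| < 3, hence u \<in> \<T>u, and |u| = q(|y|) lies strictly between the
  radii, both for r1 < r2 and for r2 < r1.

  The fixed point exists because convex combinations of values of T, formed with a partition of
  unity, turn the multivalued map into continuous maps of a compact convex set, to which Schauder's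
  theorem applies; their fixed points accumulate at a fixed point of the multivalued map.
  Schauder's theorem needs Brouwer's theorem on simplices of arbitrary dimension, which the
  type-indexed version in the library does not give; it is derived here from Kuhn's
  combinatorial lemma by way of the Hilbert cube, of which every simplex is a retract.
\<close>

section \<open>The theorems of Schauder and Mazur\<close>

definition hilbert_cube :: "(nat \<Rightarrow> real) set" where
  "hilbert_cube = (UNIV \<rightarrow> {0..1})"

lemma compact_hilbert_cube: "compact hilbert_cube"
proof -
  have "compactin (product_topology (\<lambda>_::nat. euclidean) UNIV) (UNIV \<rightarrow>\<^sub>E {0..1::real})"
    by (simp add: compactin_PiE)
  then show ?thesis
    by (simp add: hilbert_cube_def PiE_UNIV_domain euclidean_product_topology)
qed

lemma tendsto_coordinatewise_iff:
  fixes f :: "'a \<Rightarrow> 'b \<Rightarrow> 'c::topological_space"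
  shows "(f \<longlongrightarrow> l) F \<longleftrightarrow> (\<forall>i. ((\<lambda>x. f x i) \<longlongrightarrow> l i) F)"
  using limitin_componentwise[of "\<lambda>_. euclidean" UNIV f l F]
  by (simp add: euclidean_product_topology)

definition sup_cball :: "('i \<Rightarrow> real) \<Rightarrow> real \<Rightarrow> ('i \<Rightarrow> real) set" where
  "sup_cball x e = {y. \<forall>i. \<bar>y i - x i\<bar> \<le> e}"

lemma tendsto_sup_cball_transform:
  assumes x: "(x \<longlongrightarrow> l) F" and e: "(e \<longlongrightarrow> 0) F" and y: "\<forall>\<^sub>F k in F. y k \<in> sup_cball (x k) (e k)"
  shows "(y \<longlongrightarrow> l) F"
  unfolding tendsto_coordinatewise_iff
proof
  fix i
  have "((\<lambda>k. y k i - x k i) \<longlongrightarrow> 0) F"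
    using y by (intro Lim_null_comparison[OF _ e]) (auto simp: sup_cball_def elim: eventually_mono)
  with x show "((\<lambda>k. y k i) \<longlongrightarrow> l i) F"
    unfolding tendsto_coordinatewise_iff by (blast intro: Lim_transform)
qed

lemma nonneg_at_limit_of_nearby_nonneg:
  fixes g :: "('i \<Rightarrow> real) \<Rightarrow> real"
  assumes g: "continuous_on S g" and "l \<in> S" and x: "(x \<longlongrightarrow> l) F" and e: "(e \<longlongrightarrow> 0) F" and "F \<noteq> bot"
    and nearby: "\<forall>\<^sub>F k in F. \<exists>y\<in>S \<inter> sup_cball (x k) (e k). 0 \<le> g y"
  shows "0 \<le> g l"
proof -
  obtain y where y: "\<forall>\<^sub>F k in F. y k \<in> S \<inter> sup_cball (x k) (e k) \<and> 0 \<le> g (y k)"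
    using nearby unfolding Bex_def eventually_ex by blast
  then have "(y \<longlongrightarrow> l) F"
    by (intro tendsto_sup_cball_transform[OF x e]) (auto elim: eventually_mono)
  then have "((\<lambda>k. g (y k)) \<longlongrightarrow> g l) F"
    using y by (intro continuous_on_tendsto_compose[OF g _ \<open>l \<in> S\<close>]) (auto elim: eventually_mono)
  then show ?thesis
    using y \<open>F \<noteq> bot\<close> by (intro tendsto_lowerbound) (auto elim: eventually_mono)
qed

lemma LIMSEQ_one_over_Suc_subseq:
  fixes h :: "nat \<Rightarrow> nat"
  assumes "strict_mono h"
  shows "(\<lambda>k. 1 / real (Suc (h k))) \<longlonglongrightarrow> 0"
  using LIMSEQ_subseq_LIMSEQ[OF LIMSEQ_inverse_real_of_nat assms]
  by (simp add: o_def inverse_eq_divide)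

definition grid_cell :: "nat \<Rightarrow> (nat \<Rightarrow> nat) \<Rightarrow> (nat \<Rightarrow> nat) set" where
  "grid_cell n q = {r. \<forall>j<n. q j \<le> r j \<and> r j \<le> q j + 1}"

lemma grid_cell_le:
  assumes "r \<in> grid_cell n q" "\<forall>j<n. q j < p"
  shows "\<forall>j<n. r j \<le> p"
  using assms unfolding grid_cell_def by force

lemma kuhn_sign_changes:
  fixes g :: "(nat \<Rightarrow> nat) \<Rightarrow> nat \<Rightarrow> real" and n p :: nat
  assumes "0 < p"
    and lower: "\<And>x i. \<forall>j<n. x j \<le> p \<Longrightarrow> i < n \<Longrightarrow> x i = 0 \<Longrightarrow> 0 \<le> g x i"
    and upper: "\<And>x i. \<forall>j<n. x j \<le> p \<Longrightarrow> i < n \<Longrightarrow> x i = p \<Longrightarrow> g x i \<le> 0"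
  obtains q where "\<forall>i<n. q i < p"
    "\<And>i. i < n \<Longrightarrow> \<exists>r\<in>grid_cell n q. 0 \<le> g r i" "\<And>i. i < n \<Longrightarrow> \<exists>s\<in>grid_cell n q. g s i \<le> 0"
proof -
  define label :: "(nat \<Rightarrow> nat) \<Rightarrow> nat \<Rightarrow> nat" where
    "label x i = (if x i = p \<or> (x i \<noteq> 0 \<and> g x i < 0) then 1 else 0)" for x i
  obtain q where q: "\<forall>i<n. q i < p"
    and labels: "\<forall>i<n. \<exists>r s. (\<forall>j<n. q j \<le> r j \<and> r j \<le> q j + 1) \<and>
      (\<forall>j<n. q j \<le> s j \<and> s j \<le> q j + 1) \<and> label r i \<noteq> label s i"
    by (rule kuhn_lemma[OF \<open>0 < p\<close>, where n = n and label = label])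
      (use \<open>0 < p\<close> in \<open>auto simp: label_def\<close>)
  have label_0: "0 \<le> g r i" if "label r i = 0" "i < n" "r \<in> grid_cell n q" for r i
    using that lower[OF grid_cell_le[OF _ q]] by (auto simp: label_def split: if_splits)
  have label_1: "g r i \<le> 0" if "label r i = 1" "i < n" "r \<in> grid_cell n q" for r i
    using that upper[OF grid_cell_le[OF _ q]] by (auto simp: label_def split: if_splits)
  have "\<exists>r\<in>grid_cell n q. \<exists>s\<in>grid_cell n q. label r i = 0 \<and> label s i = 1" if "i < n" for i
  proof -
    obtain r s where "r \<in> grid_cell n q" "s \<in> grid_cell n q" "label r i \<noteq> label s i"
      using labels \<open>i < n\<close> unfolding grid_cell_def by blast
    moreover have "label r i = 0 \<or> label r i = 1" "label s i = 0 \<or> label s i = 1"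
      by (simp_all add: label_def)
    ultimately show ?thesis by metis
  qed
  then show thesis
    using that[OF q] label_0 label_1 by blast
qed

lemma hilbert_cube_sign_changes:
  assumes f: "f \<in> hilbert_cube \<rightarrow> hilbert_cube" and "0 < p"
  shows "\<exists>x\<in>hilbert_cube. \<forall>i<n.
    (\<exists>y\<in>hilbert_cube \<inter> sup_cball x (1 / real p). y i \<le> f y i) \<and>
    (\<exists>z\<in>hilbert_cube \<inter> sup_cball x (1 / real p). f z i \<le> z i)"
proof -
  define grid :: "(nat \<Rightarrow> nat) \<Rightarrow> nat \<Rightarrow> real"
    where "grid q = (\<lambda>j. if j < n then real (q j) / real p else 0)" for q
  have grid_in: "grid q \<in> hilbert_cube" if "\<forall>j<n. q j \<le> p" for q
    using that \<open>0 < p\<close> by (auto simp: grid_def hilbert_cube_def)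
  have f_grid: "0 \<le> f (grid q) i" "f (grid q) i \<le> 1" if "\<forall>j<n. q j \<le> p" for q i
    using f grid_in[OF that] by (auto simp: hilbert_cube_def Pi_iff)
  obtain q where q: "\<forall>i<n. q i < p"
    and up: "\<And>i. i < n \<Longrightarrow> \<exists>r\<in>grid_cell n q. 0 \<le> f (grid r) i - grid r i"
    and down: "\<And>i. i < n \<Longrightarrow> \<exists>s\<in>grid_cell n q. f (grid s) i - grid s i \<le> 0"
    by (rule kuhn_sign_changes[OF \<open>0 < p\<close>, of n "\<lambda>q i. f (grid q) i - grid q i"])
      (use \<open>0 < p\<close> f_grid in \<open>auto simp: grid_def\<close>)
  have cell_near: "grid r \<in> hilbert_cube \<inter> sup_cball (grid q) (1 / real p)"
    if r: "r \<in> grid_cell n q" for r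
  proof -
    have "\<bar>real (r j) - real (q j)\<bar> \<le> 1" if "j < n" for j
      using r that by (auto simp: grid_cell_def)
    then have "grid r \<in> sup_cball (grid q) (1 / real p)"
      using \<open>0 < p\<close>
      by (auto simp: sup_cball_def grid_def divide_right_mono simp flip: diff_divide_distrib)
    then show ?thesis
      using grid_in[OF grid_cell_le[OF r q]] by blast
  qed
  show ?thesis
  proof (rule bexI[of _ "grid q"], intro allI impI)
    fix i assume "i < n"
    then show "(\<exists>y\<in>hilbert_cube \<inter> sup_cball (grid q) (1 / real p). y i \<le> f y i) \<and>
        (\<exists>z\<in>hilbert_cube \<inter> sup_cball (grid q) (1 / real p). f z i \<le> z i)"
      using up down cell_near by (meson diff_ge_0_iff_ge diff_le_0_iff_le)
  qed (use q in \<open>simp add: grid_in less_imp_le\<close>)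
qed

theorem hilbert_cube_fixpoint:
  assumes cont: "continuous_on hilbert_cube f" and f: "f \<in> hilbert_cube \<rightarrow> hilbert_cube"
  obtains x where "x \<in> hilbert_cube" "f x = x"
proof -
  define near :: "nat \<Rightarrow> (nat \<Rightarrow> real) \<Rightarrow> (nat \<Rightarrow> real) set"
    where "near k x = hilbert_cube \<inter> sup_cball x (1 / real (Suc k))" for k x
  have "\<exists>x\<in>hilbert_cube. \<forall>i<k. (\<exists>y\<in>near k x. y i \<le> f y i) \<and> (\<exists>z\<in>near k x. f z i \<le> z i)" for k
    unfolding near_def by (rule hilbert_cube_sign_changes[OF f]) simp
  then obtain x where x: "\<And>k. x k \<in> hilbert_cube"
    and up: "\<And>k i. i < k \<Longrightarrow> \<exists>y\<in>near k (x k). y i \<le> f y i"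
    and down: "\<And>k i. i < k \<Longrightarrow> \<exists>z\<in>near k (x k). f z i \<le> z i"
    by metis
  from seq_compactE[OF compact_imp_seq_compact[OF compact_hilbert_cube] allI[OF x]]
  obtain a h where a: "a \<in> hilbert_cube" and h: "strict_mono h" and lim: "(x \<circ> h) \<longlonglongrightarrow> a" .
  have nonneg_at_a: "0 \<le> g a"
    if "continuous_on hilbert_cube g" and "\<And>k. i < k \<Longrightarrow> \<exists>y\<in>near k (x k). 0 \<le> g y"
    for g :: "(nat \<Rightarrow> real) \<Rightarrow> real" and i
  proof (rule nonneg_at_limit_of_nearby_nonneg[OF that(1) a lim LIMSEQ_one_over_Suc_subseq[OF h]])
    have "i < h k" if "Suc i \<le> k" for k
      using that seq_suble[OF h, of k] by linarith
    then show "\<forall>\<^sub>F k in sequentially.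
        \<exists>y\<in>hilbert_cube \<inter> sup_cball ((x \<circ> h) k) (1 / real (Suc (h k))). 0 \<le> g y"
      using that(2) unfolding near_def by (intro eventually_sequentiallyI[of "Suc i"]) simp
  qed simp
  have "f a i = a i" for i
  proof -
    have coordinates: "continuous_on hilbert_cube (\<lambda>x. f x i)"
      "continuous_on hilbert_cube (\<lambda>x. x i)"
      by (rule continuous_on_product_then_coordinatewise[OF cont]
          continuous_on_product_then_coordinatewise[OF continuous_on_id])+
    have "0 \<le> f a i - a i"
      using up by (intro nonneg_at_a[of "\<lambda>x. f x i - x i" i] continuous_intros coordinates) auto
    moreover have "0 \<le> a i - f a i"
      using down by (intro nonneg_at_a[of "\<lambda>x. x i - f x i" i] continuous_intros coordinates) auto
    ultimately show ?thesis by simp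
  qed
  then show thesis
    using that a by blast
qed

lemma standard_simplex_iff:
  "\<alpha> \<in> standard_simplex n \<longleftrightarrow> (\<forall>i. 0 \<le> \<alpha> i) \<and> (\<forall>i>n. \<alpha> i = 0) \<and> (\<Sum>i\<le>n. \<alpha> i) = 1"
proof -
  have "\<alpha> i \<le> 1" if "\<forall>i. 0 \<le> \<alpha> i" "\<forall>i>n. \<alpha> i = 0" "(\<Sum>i\<le>n. \<alpha> i) = 1" for i
    using that member_le_sum[of i "{..n}" \<alpha>] by (cases "i \<le> n") auto
  then show ?thesis
    by (auto simp: standard_simplex_def)
qed

lemma standard_simplex_retract_of_hilbert_cube: "standard_simplex n retract_of hilbert_cube"
proof -
  define \<sigma> :: "(nat \<Rightarrow> real) \<Rightarrow> real" where "\<sigma> \<alpha> = (\<Sum>i\<le>n. \<alpha> i)" for \<alpha>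
  \<comment> \<open>Sums above 1 are divided out; a sum below 1 is topped up at vertex 0.\<close>
  define ret :: "(nat \<Rightarrow> real) \<Rightarrow> nat \<Rightarrow> real" where
    "ret \<alpha> i = (if i \<le> n then (\<alpha> i + (if i = 0 then max 0 (1 - \<sigma> \<alpha>) else 0)) / max 1 (\<sigma> \<alpha>) else 0)"
    for \<alpha> i
  have "retraction hilbert_cube (standard_simplex n) ret"
    unfolding retraction_def
  proof (intro conjI ballI)
    show "standard_simplex n \<subseteq> hilbert_cube"
      by (auto simp: standard_simplex_def hilbert_cube_def)
    have coordinate: "continuous_on hilbert_cube (\<lambda>\<alpha>. \<alpha> i)" for i
      by (rule continuous_on_product_then_coordinatewise[OF continuous_on_id])
    then have "continuous_on hilbert_cube \<sigma>"
      unfolding \<sigma>_def by (intro continuous_intros)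
    with coordinate have "continuous_on hilbert_cube (\<lambda>\<alpha>. ret \<alpha> i)" for i
      unfolding ret_def by (cases "i \<le> n"; cases "i = 0") (auto intro!: continuous_intros)
    then show "continuous_on hilbert_cube ret"
      by (rule continuous_on_coordinatewise_then_product)
    show "ret \<in> hilbert_cube \<rightarrow> standard_simplex n"
    proof
      fix \<alpha> :: "nat \<Rightarrow> real" assume \<alpha>: "\<alpha> \<in> hilbert_cube"
      have "(\<Sum>i\<le>n. ret \<alpha> i) = (\<sigma> \<alpha> + max 0 (1 - \<sigma> \<alpha>)) / max 1 (\<sigma> \<alpha>)"
        by (simp add: ret_def sum.distrib \<sigma>_def flip: sum_divide_distrib)
      also have "\<dots> = 1"
        by (simp add: max_def)
      finally have "(\<Sum>i\<le>n. ret \<alpha> i) = 1" .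
      moreover have "0 \<le> ret \<alpha> i" for i
        using \<alpha> by (auto simp: ret_def hilbert_cube_def Pi_iff)
      ultimately show "ret \<alpha> \<in> standard_simplex n"
        by (simp add: standard_simplex_iff ret_def)
    qed
    show "ret \<alpha> = \<alpha>" if "\<alpha> \<in> standard_simplex n" for \<alpha>
      using that by (auto simp: ret_def \<sigma>_def standard_simplex_def)
  qed
  then show ?thesis
    unfolding retract_of_def by blast
qed

corollary brouwer_standard_simplex:
  assumes "continuous_on (standard_simplex n) f" "f \<in> standard_simplex n \<rightarrow> standard_simplex n"
  obtains x where "x \<in> standard_simplex n" "f x = x"
  by (rule retract_fixpoint_property[OF standard_simplex_retract_of_hilbert_cube _ assms])
    (auto elim: hilbert_cube_fixpoint intro: that)

lemma barycenter_in_convex: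
  assumes \<alpha>: "\<alpha> \<in> standard_simplex n" and "convex C" and b: "\<And>i. i \<le> n \<Longrightarrow> \<alpha> i \<noteq> 0 \<Longrightarrow> b i \<in> C"
  shows "(\<Sum>i\<le>n. \<alpha> i *\<^sub>R b i) \<in> C"
proof -
  define S where "S = {i. i \<le> n \<and> \<alpha> i \<noteq> 0}"
  have "sum \<alpha> S = (\<Sum>i\<le>n. \<alpha> i)"
    unfolding S_def by (rule sum.mono_neutral_left) auto
  then have "(\<Sum>i\<in>S. \<alpha> i *\<^sub>R b i) \<in> C"
    using \<alpha> b \<open>convex C\<close> by (intro convex_sum) (auto simp: S_def standard_simplex_def)
  also have "(\<Sum>i\<in>S. \<alpha> i *\<^sub>R b i) = (\<Sum>i\<le>n. \<alpha> i *\<^sub>R b i)"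
    unfolding S_def by (rule sum.mono_neutral_left) auto
  finally show ?thesis .
qed

lemma continuous_on_barycenter:
  fixes b :: "nat \<Rightarrow> 'a::real_normed_vector"
  assumes "continuous_on S \<alpha>"
  shows "continuous_on S (\<lambda>x. \<Sum>i\<le>n. \<alpha> x i *\<^sub>R b i)"
  using continuous_on_product_then_coordinatewise[OF assms] by (intro continuous_intros)

lemma compact_imp_finite_net_indexed:
  fixes S :: "'a::metric_space set"
  assumes "compact S" "S \<noteq> {}" "0 < e"
  obtains n :: nat and b :: "nat \<Rightarrow> 'a" where "b ` {..n} \<subseteq> S" "S \<subseteq> (\<Union>i\<le>n. ball (b i) e)"
proof -
  obtain B where B: "B \<subseteq> S" "finite B" "S \<subseteq> (\<Union>x\<in>B. ball x e)"
    by (rule compactE_image[OF \<open>compact S\<close>, of S "\<lambda>x. ball x e"]) (use \<open>0 < e\<close> in auto)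
  then have "B \<noteq> {}"
    using \<open>S \<noteq> {}\<close> by auto
  obtain m :: nat and b where b: "B = b ` {i. i < m}"
    using finite_imp_nat_seg_image_inj_on[OF B(2)] by blast
  then obtain n where "m = Suc n"
    using \<open>B \<noteq> {}\<close> by (cases m) auto
  then have "B = b ` {..n}"
    using b by (simp add: less_Suc_eq_le atMost_def)
  then show thesis
    using that[of b n] B by simp
qed

lemma barycentric_coordinates_net:
  fixes S :: "'a::metric_space set"
  assumes "compact S" "S \<noteq> {}" "0 < e"
  obtains n :: nat and b :: "nat \<Rightarrow> 'a" and \<alpha> :: "'a \<Rightarrow> nat \<Rightarrow> real"
  where "b ` {..n} \<subseteq> S" "continuous_on S \<alpha>" "\<alpha> ` S \<subseteq> standard_simplex n"
    "\<And>x i. x \<in> S \<Longrightarrow> \<alpha> x i \<noteq> 0 \<Longrightarrow> dist x (b i) < e"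
proof -
  obtain n :: nat and b where b: "b ` {..n} \<subseteq> S" and net: "S \<subseteq> (\<Union>i\<le>n. ball (b i) e)"
    by (rule compact_imp_finite_net_indexed[OF assms])
  define \<psi> where "\<psi> i x = (if i \<le> n then max 0 (e - dist x (b i)) else 0)" for i x
  define \<Sigma> where "\<Sigma> x = (\<Sum>i\<le>n. \<psi> i x)" for x
  have \<psi>_nonneg: "0 \<le> \<psi> i x" for i x
    by (simp add: \<psi>_def)
  have \<Sigma>_pos: "0 < \<Sigma> x" if "x \<in> S" for x
  proof -
    obtain i where "i \<le> n" "dist x (b i) < e"
      using net \<open>x \<in> S\<close> by (auto simp: dist_commute)
    then show ?thesis
      unfolding \<Sigma>_def using \<psi>_nonneg by (intro sum_pos2[of _ i]) (auto simp: \<psi>_def)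
  qed
  have \<psi>_cont: "continuous_on S (\<psi> i)" for i
    unfolding \<psi>_def by (cases "i \<le> n") (auto intro!: continuous_intros)
  show thesis
  proof (rule that[of b n "\<lambda>x i. \<psi> i x / \<Sigma> x"])
    show "continuous_on S (\<lambda>x i. \<psi> i x / \<Sigma> x)"
      unfolding \<Sigma>_def using \<Sigma>_pos[unfolded \<Sigma>_def]
      by (intro continuous_on_coordinatewise_then_product continuous_intros \<psi>_cont) force+
    show "(\<lambda>x i. \<psi> i x / \<Sigma> x) ` S \<subseteq> standard_simplex n"
    proof (rule image_subsetI)
      fix x assume "x \<in> S"
      then have "(\<Sum>i\<le>n. \<psi> i x / \<Sigma> x) = 1"
        using \<Sigma>_pos[of x] by (simp add: \<Sigma>_def flip: sum_divide_distrib)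
      then show "(\<lambda>i. \<psi> i x / \<Sigma> x) \<in> standard_simplex n"
        using \<Sigma>_pos[OF \<open>x \<in> S\<close>] \<psi>_nonneg by (simp add: standard_simplex_iff \<psi>_def)
    qed
    show "dist x (b i) < e" if "\<psi> i x / \<Sigma> x \<noteq> 0" for x i
      using that by (auto simp: \<psi>_def max_def split: if_splits)
  qed (rule b)
qed

lemma schauder_approximate_fixpoint:
  fixes S :: "'a::real_normed_vector set"
  assumes S: "compact S" "convex S" "S \<noteq> {}"
    and f: "continuous_on S f" "f ` S \<subseteq> S" and "0 < e"
  obtains x where "x \<in> S" "dist (f x) x < e"
proof -
  obtain n and b :: "nat \<Rightarrow> 'a" and \<alpha>
    where b: "b ` {..n} \<subseteq> S"
      and \<alpha>: "continuous_on S \<alpha>" "\<alpha> ` S \<subseteq> standard_simplex n"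
      and \<alpha>_near: "\<And>x i. x \<in> S \<Longrightarrow> \<alpha> x i \<noteq> 0 \<Longrightarrow> dist x (b i) < e"
    by (rule barycentric_coordinates_net[OF S(1,3) \<open>0 < e\<close>]) blast
  define bary where "bary \<beta> = (\<Sum>i\<le>n. \<beta> i *\<^sub>R b i)" for \<beta> :: "nat \<Rightarrow> real"
  have bary_in: "bary \<beta> \<in> S" if "\<beta> \<in> standard_simplex n" for \<beta>
    unfolding bary_def using b by (intro barycenter_in_convex[OF that S(2)]) auto
  have "continuous_on (standard_simplex n) bary"
    unfolding bary_def by (intro continuous_on_barycenter continuous_on_id)
  then have "continuous_on (standard_simplex n) (\<lambda>\<beta>. f (bary \<beta>))"
    by (rule continuous_on_compose2[OF f(1)]) (use bary_in in blast)
  then have "continuous_on (standard_simplex n) (\<lambda>\<beta>. \<alpha> (f (bary \<beta>)))"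
    by (rule continuous_on_compose2[OF \<alpha>(1)]) (use bary_in f(2) in blast)
  then obtain \<beta> where \<beta>: "\<beta> \<in> standard_simplex n" "\<alpha> (f (bary \<beta>)) = \<beta>"
    by (rule brouwer_standard_simplex) (use bary_in f(2) \<alpha>(2) in blast)+
  define z where "z = f (bary \<beta>)"
  have "z \<in> S"
    using bary_in \<beta>(1) f(2) by (auto simp: z_def)
  then have "bary \<beta> \<in> ball z e"
    unfolding bary_def using \<alpha>_near[of z] \<beta> by (intro barycenter_in_convex) (auto simp: z_def)
  then show thesis
    using that[OF bary_in[OF \<beta>(1)]] by (simp add: z_def)
qed

theorem schauder_fixpoint:
  fixes S :: "'a::real_normed_vector set"
  assumes S: "compact S" "convex S" "S \<noteq> {}" and f: "continuous_on S f" "f ` S \<subseteq> S"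
  obtains x where "x \<in> S" "f x = x"
proof -
  have "continuous_on S (\<lambda>x. dist (f x) x)"
    using f(1) by (intro continuous_intros)
  then obtain x where x: "x \<in> S" "\<And>z. z \<in> S \<Longrightarrow> dist (f x) x \<le> dist (f z) z"
    using continuous_attains_inf[OF S(1,3)] by blast
  have "\<not> 0 < dist (f x) x"
    using schauder_approximate_fixpoint[OF S f] x(2) by (metis not_less)
  then show thesis
    using that x(1) by simp
qed

lemma closure_convex_hull_subset_cballs:
  fixes S :: "'a::real_normed_vector set"
  assumes "finite A" and S: "S \<subseteq> (\<Union>a\<in>A. cball a e)"
  shows "closure (convex hull S) \<subseteq> (\<Union>a\<in>convex hull A. cball a e)"
proof -
  have "(\<Union>a\<in>convex hull A. cball a e) = (\<Union>a\<in>convex hull A. \<Union>d\<in>cball 0 e. {a + d})"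
  proof (intro SUP_cong refl equalityI subsetI)
    show "x \<in> (\<Union>d\<in>cball 0 e. {a + d})" if "x \<in> cball a e" for a x :: 'a
      using that by (auto simp: dist_norm norm_minus_commute intro!: bexI[of _ "x - a"])
  qed (auto simp: dist_norm)
  moreover have "compact (convex hull A)"
    using \<open>finite A\<close> by (rule finite_imp_compact_convex_hull)
  ultimately have "closed (\<Union>a\<in>convex hull A. cball a e)" "convex (\<Union>a\<in>convex hull A. cball a e)"
    by (simp_all add: compact_closed_sums convex_sums)
  moreover have "S \<subseteq> (\<Union>a\<in>convex hull A. cball a e)"
    using S hull_inc[of _ A convex] by blast
  ultimately show ?thesis
    by (intro closure_minimal hull_minimal)
qed

theorem compact_closure_convex_hull:
  fixes S :: "'a::banach set"
  assumes "compact (closure S)"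
  shows "compact (closure (convex hull S))"
  unfolding compact_eq_totally_bounded
proof (intro conjI allI impI)
  show "complete (closure (convex hull S))"
    by (simp add: complete_eq_closed)
  fix e :: real assume "0 < e"
  then have "0 < e/2" by simp
  obtain A where A: "finite A" "closure S \<subseteq> (\<Union>a\<in>A. ball a (e/2))"
    using assms \<open>0 < e/2\<close> unfolding compact_eq_totally_bounded by blast
  obtain B where B: "finite B" "convex hull A \<subseteq> (\<Union>b\<in>B. ball b (e/2))"
    using finite_imp_compact_convex_hull[OF A(1)] \<open>0 < e/2\<close>
    unfolding compact_eq_totally_bounded by blast
  have "S \<subseteq> (\<Union>a\<in>A. ball a (e/2))"
    using closure_subset A(2) by (rule order_trans)
  also have "\<dots> \<subseteq> (\<Union>a\<in>A. cball a (e/2))"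
    by (intro UN_mono) auto
  finally have "closure (convex hull S) \<subseteq> (\<Union>a\<in>convex hull A. cball a (e/2))"
    by (rule closure_convex_hull_subset_cballs[OF A(1)])
  also have "\<dots> \<subseteq> (\<Union>b\<in>B. ball b e)"
  proof
    fix x assume "x \<in> (\<Union>a\<in>convex hull A. cball a (e/2))"
    then obtain a where a: "a \<in> convex hull A" "dist a x \<le> e/2" by auto
    then obtain b where "b \<in> B" "dist b a < e/2"
      using B(2) by auto
    moreover from this have "dist b x < e"
      using a(2) dist_triangle[of b x a] by simp
    ultimately show "x \<in> (\<Union>b\<in>B. ball b e)" by auto
  qed
  finally show "\<exists>B. finite B \<and> closure (convex hull S) \<subseteq> (\<Union>b\<in>B. ball b e)"
    using B(1) by blast
qed

section \<open>Fixed points of the closed-convex envelope\<close>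

definition local_hull :: "('a::metric_space \<Rightarrow> 'b::real_vector) \<Rightarrow> 'a set \<Rightarrow> real \<Rightarrow> 'a \<Rightarrow> 'b set" where
  "local_hull T D e x = convex hull (T ` (cball x e \<inter> D))"

lemma cc_envelope_eq_local_hull: "cc_envelope T D x = (\<Inter>e\<in>{0<..}. closure (local_hull T D e x))"
  by (simp add: cc_envelope_def local_hull_def)

lemma local_hull_subset: "local_hull T D e x \<subseteq> convex hull (T ` D)"
  unfolding local_hull_def by (intro hull_mono) blast

lemma local_hull_mono:
  assumes "dist a x + e \<le> e'"
  shows "local_hull T D e x \<subseteq> local_hull T D e' a"
proof -
  have "cball x e \<subseteq> cball a e'"
  proof
    fix z assume "z \<in> cball x e"
    then show "z \<in> cball a e'"
      using assms dist_triangle[of a z x] by simp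
  qed
  then show ?thesis
    unfolding local_hull_def by (intro hull_mono) blast
qed

lemma cc_envelope_subset: "cc_envelope T D x \<subseteq> closure (convex hull (T ` D))"
proof -
  have "cc_envelope T D x \<subseteq> closure (local_hull T D 1 x)"
    unfolding cc_envelope_eq_local_hull by (rule INT_lower) simp
  also have "\<dots> \<subseteq> closure (convex hull (T ` D))"
    by (intro closure_mono local_hull_subset)
  finally show ?thesis .
qed

lemma cc_envelope_limit:
  assumes x: "x \<longlonglongrightarrow> a" and v: "v \<longlonglongrightarrow> b" and e: "e \<longlonglongrightarrow> 0"
    and mem: "\<And>n. v n \<in> local_hull T D (e n) (x n)"
  shows "b \<in> cc_envelope T D a"
  unfolding cc_envelope_eq_local_hull
proof (intro INT_I)
  fix \<epsilon> :: real assume "\<epsilon> \<in> {0<..}"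
  moreover have "(\<lambda>n. dist a (x n) + e n) \<longlonglongrightarrow> 0"
    using tendsto_add[OF tendsto_dist[OF tendsto_const[of a] x] e] by simp
  ultimately have "\<forall>\<^sub>F n in sequentially. dist a (x n) + e n < \<epsilon>"
    using order_tendstoD(2) by auto
  then have "\<forall>\<^sub>F n in sequentially. v n \<in> closure (local_hull T D \<epsilon> a)"
  proof eventually_elim
    case (elim n)
    then show ?case
      using mem[of n] local_hull_mono[of a "x n" "e n" \<epsilon>] closure_subset
      by (meson less_imp_le subsetD)
  qed
  then show "b \<in> closure (local_hull T D \<epsilon> a)"
    using Lim_in_closed_set[OF closed_closure _ _ v] by simp
qed

lemma local_hull_continuous_selection:
  fixes T :: "'a::metric_space \<Rightarrow> 'b::real_normed_vector"
  assumes Q: "compact Q" "Q \<noteq> {}" and p: "continuous_on Q p" "p ` Q \<subseteq> D" and "0 < e"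
  obtains f where "continuous_on Q f" "\<And>y. y \<in> Q \<Longrightarrow> f y \<in> local_hull T D e (p y)"
proof -
  have pQ: "compact (p ` Q)" "p ` Q \<noteq> {}"
    using Q p(1) by (auto intro: compact_continuous_image)
  obtain n b \<alpha> where b: "b ` {..n} \<subseteq> p ` Q"
    and \<alpha>: "continuous_on (p ` Q) \<alpha>" "\<alpha> ` p ` Q \<subseteq> standard_simplex n"
    and \<alpha>_near: "\<And>x i. x \<in> p ` Q \<Longrightarrow> \<alpha> x i \<noteq> 0 \<Longrightarrow> dist x (b i) < e"
    by (rule barycentric_coordinates_net[OF pQ \<open>0 < e\<close>]) blast
  show thesis
  proof (rule that[of "\<lambda>y. \<Sum>i\<le>n. \<alpha> (p y) i *\<^sub>R T (b i)"])
    show "continuous_on Q (\<lambda>y. \<Sum>i\<le>n. \<alpha> (p y) i *\<^sub>R T (b i))"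
      by (intro continuous_on_barycenter continuous_on_compose2[OF \<alpha>(1) p(1)]) simp
    show "(\<Sum>i\<le>n. \<alpha> (p y) i *\<^sub>R T (b i)) \<in> local_hull T D e (p y)" if "y \<in> Q" for y
      unfolding local_hull_def
    proof (rule barycenter_in_convex)
      fix i assume "i \<le> n" "\<alpha> (p y) i \<noteq> 0"
      then have "b i \<in> cball (p y) e \<inter> D"
        using \<alpha>_near[of "p y" i] b p(2) \<open>y \<in> Q\<close> by force
      then show "T (b i) \<in> convex hull (T ` (cball (p y) e \<inter> D))"
        by (intro hull_inc imageI)
    qed (use \<alpha>(2) \<open>y \<in> Q\<close> in auto)
  qed
qed

lemma local_hull_fixpoint:
  fixes T :: "'a::metric_space \<Rightarrow> 'b::real_normed_vector" and p :: "'c::real_normed_vector \<Rightarrow> 'a"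
  assumes Q: "compact Q" "convex Q" "Q \<noteq> {}"
    and p: "continuous_on Q p" "p ` Q \<subseteq> D"
    and \<Phi>: "continuous_on (Q \<times> M) \<Phi>" "\<Phi> ` (Q \<times> M) \<subseteq> Q"
    and M: "convex hull (T ` D) \<subseteq> M" and "0 < e"
  obtains y v where "(y, v) \<in> Q \<times> M" "v \<in> local_hull T D e (p y)" "\<Phi> (y, v) = y"
proof -
  obtain f where f: "continuous_on Q f" and f_in: "\<And>y. y \<in> Q \<Longrightarrow> f y \<in> local_hull T D e (p y)"
    by (rule local_hull_continuous_selection[OF Q(1,3) p \<open>0 < e\<close>]) blast
  have fM: "f y \<in> M" if "y \<in> Q" for y
    using f_in[OF that] local_hull_subset M by blast
  have "continuous_on Q (\<lambda>y. \<Phi> (y, f y))"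
    using fM by (intro continuous_on_compose2[OF \<Phi>(1)] continuous_intros f) auto
  then obtain y where "y \<in> Q" "\<Phi> (y, f y) = y"
    by (rule schauder_fixpoint[OF Q]) (use \<Phi>(2) fM in blast)+
  then show thesis
    using that fM f_in by blast
qed

theorem cc_envelope_fixpoint:
  fixes T :: "'a::banach \<Rightarrow> 'a" and D :: "'a set" and p :: "'b::real_normed_vector \<Rightarrow> 'a"
  defines "M \<equiv> closure (convex hull (T ` D))"
  assumes T: "compact (closure (T ` D))"
    and Q: "compact Q" "convex Q" "Q \<noteq> {}"
    and p: "continuous_on Q p" "p ` Q \<subseteq> D"
    and \<Phi>: "continuous_on (Q \<times> M) \<Phi>" "\<Phi> ` (Q \<times> M) \<subseteq> Q"
  obtains y v where "y \<in> Q" "v \<in> cc_envelope T D (p y)" "\<Phi> (y, v) = y"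
proof -
  have hull_M: "convex hull (T ` D) \<subseteq> M"
    unfolding M_def by (rule closure_subset)
  have "\<exists>y v. (y, v) \<in> Q \<times> M \<and> v \<in> local_hull T D (1 / real (Suc n)) (p y) \<and> \<Phi> (y, v) = y" for n
    by (rule local_hull_fixpoint[OF Q p \<Phi> hull_M, of "1 / real (Suc n)"]) (simp, blast)
  then obtain y v where yv: "\<And>n. (y n, v n) \<in> Q \<times> M" and fixed: "\<And>n. \<Phi> (y n, v n) = y n"
    and v: "\<And>n. v n \<in> local_hull T D (1 / real (Suc n)) (p (y n))"
    by metis
  have "compact (Q \<times> M)"
    unfolding M_def by (intro compact_Times Q(1) compact_closure_convex_hull T)
  from seq_compactE[OF compact_imp_seq_compact[OF this] allI[OF yv]]
  obtain z h where "z \<in> Q \<times> M" and h: "strict_mono (h :: nat \<Rightarrow> nat)"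
    and "((\<lambda>n. (y n, v n)) \<circ> h) \<longlonglongrightarrow> z" .
  then obtain a b where ab: "(a, b) \<in> Q \<times> M" and lim: "((\<lambda>n. (y n, v n)) \<circ> h) \<longlonglongrightarrow> (a, b)"
    by (cases z) blast
  have y_lim: "(\<lambda>n. y (h n)) \<longlonglongrightarrow> a" and v_lim: "(\<lambda>n. v (h n)) \<longlonglongrightarrow> b"
    using tendsto_fst[OF lim] tendsto_snd[OF lim] by (simp_all add: o_def)
  have "(\<lambda>n. \<Phi> (y (h n), v (h n))) \<longlonglongrightarrow> \<Phi> (a, b)"
    using continuous_on_tendsto_compose[OF \<Phi>(1) lim ab] yv by (simp add: o_def)
  then have "\<Phi> (a, b) = a"
    using fixed y_lim LIMSEQ_unique by simp
  moreover have "b \<in> cc_envelope T D (p a)"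
  proof (rule cc_envelope_limit[OF _ v_lim LIMSEQ_one_over_Suc_subseq[OF h] v])
    show "(\<lambda>n. p (y (h n))) \<longlonglongrightarrow> p a"
      using continuous_on_tendsto_compose[OF p(1) y_lim] ab yv by simp
  qed
  ultimately show thesis
    using that ab by blast
qed

definition radial_retraction :: "real \<Rightarrow> 'a::real_normed_vector \<Rightarrow> 'a" where
  "radial_retraction \<rho> z = (\<rho> / max \<rho> (norm z)) *\<^sub>R z"

lemma continuous_on_radial_retraction:
  assumes "0 < \<rho>" "continuous_on S f"
  shows "continuous_on S (\<lambda>x. radial_retraction \<rho> (f x))"
  unfolding radial_retraction_def using assms by (intro continuous_intros) auto

lemma norm_radial_retraction:
  assumes "0 < \<rho>"
  shows "norm (radial_retraction \<rho> z) = min \<rho> (norm z)"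
  using assms by (auto simp: radial_retraction_def max_def min_def)

lemma radial_retraction_in_convex:
  assumes "0 < \<rho>" "convex C" "0 \<in> C" "z \<in> C"
  shows "radial_retraction \<rho> z \<in> C"
  unfolding radial_retraction_def
  using convexD_alt[OF assms(2-4), of "\<rho> / max \<rho> (norm z)"] \<open>0 < \<rho>\<close> by simp

lemma radial_retraction_scale:
  assumes "0 < \<rho>"
  obtains l where "1 \<le> l" "l *\<^sub>R radial_retraction \<rho> z = z"
    "l = 1 \<or> norm (radial_retraction \<rho> z) = \<rho>"
proof (rule that[of "max \<rho> (norm z) / \<rho>"])
  show "max \<rho> (norm z) / \<rho> = 1 \<or> norm (radial_retraction \<rho> z) = \<rho>"
    using assms by (simp add: norm_radial_retraction) linarith
qed (use assms in \<open>auto simp: radial_retraction_def max_def\<close>)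

lemma compact_convex_superset_radial_retraction:
  fixes K :: "'a::banach set"
  assumes K: "closed K" "convex K" "0 \<in> K" and W: "compact W" "W \<subseteq> K" and "0 < \<rho>"
  obtains Q where "compact Q" "convex Q" "0 \<in> Q" "Q \<subseteq> K \<inter> cball 0 \<rho>" "radial_retraction \<rho> ` W \<subseteq> Q"
proof -
  define H where "H = closure (convex hull (insert 0 W))"
  have "compact H"
    unfolding H_def using W(1)
    by (intro compact_closure_convex_hull) (simp add: compact_insert compact_imp_closed)
  have "convex H"
    unfolding H_def by (simp add: convex_closure)
  have "insert 0 W \<subseteq> H"
    unfolding H_def by (rule order_trans[OF hull_subset closure_subset])
  have "H \<subseteq> K"
    unfolding H_def using K W(2) by (intro closure_minimal hull_minimal) auto
  show thesis
  proof (rule that[of "cball 0 \<rho> \<inter> H"])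
    show "compact (cball 0 \<rho> \<inter> H)"
      using \<open>compact H\<close> by (intro closed_Int_compact closed_cball)
    show "convex (cball 0 \<rho> \<inter> H)"
      using \<open>convex H\<close> by (intro convex_Int convex_cball)
    show "radial_retraction \<rho> ` W \<subseteq> cball 0 \<rho> \<inter> H"
      using \<open>0 < \<rho>\<close> \<open>convex H\<close> \<open>insert 0 W \<subseteq> H\<close>
      by (auto simp: norm_radial_retraction intro: radial_retraction_in_convex)
  qed (use \<open>0 < \<rho>\<close> \<open>insert 0 W \<subseteq> H\<close> \<open>H \<subseteq> K\<close> in auto)
qed

theorem cc_envelope_leray_schauder:
  fixes K D :: "'a::banach set" and T p :: "'a \<Rightarrow> 'a" and F :: "'a \<times> 'a \<Rightarrow> 'a" and \<rho> :: real
  defines "B \<equiv> K \<inter> cball 0 \<rho>" and "M \<equiv> closure (convex hull (T ` D))"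
  assumes K: "closed K" "convex K" "0 \<in> K" and "0 < \<rho>"
    and T: "compact (closure (T ` D))"
    and p: "continuous_on B p" "p ` B \<subseteq> D"
    and F: "continuous_on (B \<times> M) F" "F ` (B \<times> M) \<subseteq> W"
    and W: "compact W" "W \<subseteq> K"
  obtains y v l where "y \<in> B" "v \<in> cc_envelope T D (p y)" "1 \<le> l"
    "l *\<^sub>R y = F (y, v)" "l = 1 \<or> norm y = \<rho>"
proof -
  obtain Q where Q: "compact Q" "convex Q" "0 \<in> Q" "Q \<subseteq> B"
    and retract_in: "radial_retraction \<rho> ` W \<subseteq> Q"
    unfolding B_def by (rule compact_convex_superset_radial_retraction[OF K W \<open>0 < \<rho>\<close>])
  have p_Q: "continuous_on Q p" "p ` Q \<subseteq> D"
    using p continuous_on_subset[OF p(1) Q(4)] Q(4) by auto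
  have "Q \<times> M \<subseteq> B \<times> M"
    using Q(4) by blast
  then have retracted: "continuous_on (Q \<times> M) (\<lambda>z. radial_retraction \<rho> (F z))"
    "(\<lambda>z. radial_retraction \<rho> (F z)) ` (Q \<times> M) \<subseteq> Q"
    using F(2) retract_in \<open>0 < \<rho>\<close>
    by (auto intro!: continuous_on_radial_retraction continuous_on_subset[OF F(1)])
  have "Q \<noteq> {}"
    using Q(3) by blast
  obtain y v where y: "y \<in> Q" and v: "v \<in> cc_envelope T D (p y)"
    and fixed: "radial_retraction \<rho> (F (y, v)) = y"
    by (rule cc_envelope_fixpoint[OF T Q(1,2) \<open>Q \<noteq> {}\<close> p_Q retracted[unfolded M_def]])
  obtain l where "1 \<le> l" "l *\<^sub>R y = F (y, v)" "l = 1 \<or> norm y = \<rho>"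
    using radial_retraction_scale[OF \<open>0 < \<rho>\<close>, of "F (y, v)"] unfolding fixed by blast
  then show thesis
    using that y v Q(4) by blast
qed

lemma cc_envelope_leray_schauder_cone:
  fixes K :: "'a::banach set" and T p :: "'a \<Rightarrow> 'a" and c d :: "'a \<Rightarrow> real" and \<rho> :: real
  defines "B \<equiv> K \<inter> cball 0 \<rho>"
  assumes K: "closed K" "convex_cone K" and "0 < \<rho>"
    and T: "T ` D \<subseteq> K" "compact (closure (T ` D))"
    and p: "continuous_on B p" "p ` B \<subseteq> D"
    and c: "continuous_on B c" "c ` B \<subseteq> {0..a}"
    and d: "continuous_on B d" "d ` B \<subseteq> {0..b}"
    and w: "w \<in> K"
  obtains y v l where "y \<in> B" "v \<in> cc_envelope T D (p y)" "1 \<le> l"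
    "l *\<^sub>R y = c y *\<^sub>R (v + d y *\<^sub>R w)" "l = 1 \<or> norm y = \<rho>"
proof -
  define M where "M = closure (convex hull (T ` D))"
  define F where "F = (\<lambda>(y, v). c y *\<^sub>R (v + d y *\<^sub>R w))"
  define W where "W = (\<lambda>(k, t, v). k *\<^sub>R (v + t *\<^sub>R w)) ` ({0..a} \<times> {0..b} \<times> M)"
  have cone: "convex K" "0 \<in> K"
    using K(2) by (simp_all add: convex_cone_def convex_cone_contains_0)
  have "M \<subseteq> K"
    unfolding M_def using T(1) K(1) cone(1) by (intro closure_minimal hull_minimal)
  then have "W \<subseteq> K"
    using K(2) w by (auto simp: W_def intro!: convex_cone_scaleR convex_cone_add)
  have "compact M"
    unfolding M_def using T(2) by (rule compact_closure_convex_hull)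
  then have "compact W"
    unfolding W_def split_beta
    by (intro compact_continuous_image continuous_intros compact_Times compact_Icc)
  have "continuous_on (B \<times> M) (\<lambda>z. c (fst z))" "continuous_on (B \<times> M) (\<lambda>z. d (fst z))"
    by (auto intro!: continuous_on_compose2[OF c(1)] continuous_on_compose2[OF d(1)]
        continuous_intros)
  then have F_cont: "continuous_on (B \<times> M) F"
    unfolding F_def split_beta by (intro continuous_intros)
  have "F (y, v) \<in> W" if "y \<in> B" "v \<in> M" for y v
    unfolding F_def W_def using that c(2) d(2)
    by (intro image_eqI[of _ _ "(c y, d y, v)"]) auto
  then have F_range: "F ` (B \<times> M) \<subseteq> W" by blast
  obtain y v l where "y \<in> B" "v \<in> cc_envelope T D (p y)" "1 \<le> l"
    "l *\<^sub>R y = F (y, v)" "l = 1 \<or> norm y = \<rho>"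
    unfolding B_def
    by (rule cc_envelope_leray_schauder[OF K(1) cone \<open>0 < \<rho>\<close> T(2) p[unfolded B_def]
          F_cont[unfolded B_def M_def] F_range[unfolded B_def M_def] \<open>compact W\<close> \<open>W \<subseteq> K\<close>])
  then show thesis
    using that by (simp add: F_def)
qed

section \<open>Compression and expansion of a cone\<close>

definition annulus_radius :: "real \<Rightarrow> real \<Rightarrow> real \<Rightarrow> real" where
  "annulus_radius r1 r2 s = linepath r2 r1 (max 0 (s - 2))"

lemma annulus_radius_simps:
  "s \<le> 2 \<Longrightarrow> annulus_radius r1 r2 s = r2" "annulus_radius r1 r2 3 = r1"
  by (simp_all add: annulus_radius_def linepath_def)

lemma continuous_on_annulus_radius:
  assumes "continuous_on S f"
  shows "continuous_on S (\<lambda>x. annulus_radius r1 r2 (f x))"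
  unfolding annulus_radius_def linepath_def using assms by (intro continuous_intros)

lemma annulus_radius_bounds:
  assumes "s \<le> 3"
  shows "annulus_radius r1 r2 s \<in> {min r1 r2..max r1 r2}"
  using linepath_in_path[of "max 0 (s - 2)" r2 r1] assms
  by (auto simp: annulus_radius_def closed_segment_eq_real_ivl split: if_splits)

lemma annulus_radius_pos:
  assumes "0 < r1" "0 < r2" "s \<le> 3"
  shows "0 < annulus_radius r1 r2 s"
  using annulus_radius_bounds[OF assms(3), of r1 r2] assms(1,2)
  by (simp add: min_def split: if_splits)

lemma annulus_radius_strict_bounds:
  assumes "2 < s" "s < 3" "r1 \<noteq> r2"
  shows "annulus_radius r1 r2 s \<in> {min r1 r2<..<max r1 r2}"
  using linepath_in_open_segment[of "max 0 (s - 2)" r2 r1] assms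
  by (auto simp: annulus_radius_def open_segment_eq_real_ivl split: if_splits)

definition annulus_scale :: "real \<Rightarrow> real \<Rightarrow> real \<Rightarrow> real" where
  "annulus_scale r1 r2 s = max 1 s / annulus_radius r1 r2 s"

lemma annulus_scale_bounds:
  assumes "0 < r1" "0 < r2" "s \<le> 3"
  shows "0 < annulus_scale r1 r2 s" "annulus_scale r1 r2 s \<le> 3 / min r1 r2"
  using annulus_radius_pos[OF assms] annulus_radius_bounds[OF assms(3), of r1 r2] assms
  by (auto simp: annulus_scale_def intro!: frac_le)

lemma continuous_on_annulus_scale:
  assumes "0 < r1" "0 < r2" "continuous_on S f" "\<And>x. x \<in> S \<Longrightarrow> f x \<le> 3"
  shows "continuous_on S (\<lambda>x. annulus_scale r1 r2 (f x))"
proof -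
  have "annulus_radius r1 r2 (f x) \<noteq> 0" if "x \<in> S" for x
    using annulus_radius_pos[OF assms(1,2) assms(4)[OF that]] by simp
  then show ?thesis
    unfolding annulus_scale_def using assms(3)
    by (intro continuous_on_annulus_radius continuous_intros) auto
qed

lemma norm_divide_annulus_scale:
  fixes y :: "'a::real_normed_vector"
  assumes "0 < r1" "0 < r2" "norm y \<le> 3"
  shows "norm (y /\<^sub>R annulus_scale r1 r2 (norm y)) = min 1 (norm y) * annulus_radius r1 r2 (norm y)"
  using annulus_radius_pos[OF assms] by (simp add: annulus_scale_def max_def min_def)

lemma divide_annulus_scale_in_cone:
  assumes "convex_cone K" "0 < r1" "0 < r2" and y: "y \<in> K \<inter> cball 0 3"
  shows "y /\<^sub>R annulus_scale r1 r2 (norm y) \<in> K \<inter> cball 0 (max r1 r2)"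
proof -
  have norm_le: "norm y \<le> 3"
    using y by simp
  have "y /\<^sub>R annulus_scale r1 r2 (norm y) \<in> K"
    using y annulus_scale_bounds(1)[OF assms(2,3) norm_le]
    by (intro convex_cone_scaleR[OF assms(1)]) auto
  moreover have "norm (y /\<^sub>R annulus_scale r1 r2 (norm y)) \<le> annulus_radius r1 r2 (norm y)"
    unfolding norm_divide_annulus_scale[OF assms(2,3) norm_le]
    using annulus_radius_pos[OF assms(2,3) norm_le] by (intro mult_left_le_one_le) auto
  ultimately show ?thesis
    using annulus_radius_bounds[OF norm_le, of r1 r2] by simp
qed

lemma cc_envelope_annulus_fixpoint:
  fixes K :: "'a::banach set" and r1 r2 \<Lambda> :: real
  assumes K: "closed K" "convex_cone K" and r: "0 < r1" "0 < r2"
    and D: "K \<inter> cball 0 (max r1 r2) \<subseteq> D"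
    and T: "T ` D \<subseteq> K" "compact (closure (T ` D))"
    and w: "w \<in> K" and "0 \<le> \<Lambda>"
  obtains s u v l where "0 \<le> s" "s \<le> 3" "u \<in> K" "norm u = min 1 s * annulus_radius r1 r2 s"
    "v \<in> cc_envelope T D u" "1 \<le> l" "l = 1 \<or> s = 3"
    "l *\<^sub>R u = v + (\<Lambda> * max 0 (min 1 (2 - s))) *\<^sub>R w"
proof -
  let ?B = "K \<inter> cball 0 3"
  define c where "c y = annulus_scale r1 r2 (norm y)" for y :: 'a
  define d where "d y = \<Lambda> * max 0 (min 1 (2 - norm y))" for y :: 'a
  have c_pos: "0 < c y" and c_le: "c y \<le> 3 / min r1 r2" if "y \<in> ?B" for y
    using annulus_scale_bounds[OF r, of "norm y"] that by (simp_all add: c_def)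
  have c: "continuous_on ?B c" "c ` ?B \<subseteq> {0..3 / min r1 r2}"
    unfolding c_def using r c_pos c_le
    by (auto simp: c_def less_imp_le intro!: continuous_on_annulus_scale continuous_intros)
  have d: "continuous_on ?B d" "d ` ?B \<subseteq> {0..\<Lambda>}"
    using \<open>0 \<le> \<Lambda>\<close> by (auto simp: d_def intro!: mult_left_le continuous_intros)
  have u_in: "y /\<^sub>R c y \<in> K \<inter> cball 0 (max r1 r2)" if "y \<in> ?B" for y
    unfolding c_def by (rule divide_annulus_scale_in_cone[OF K(2) r that])
  have u: "continuous_on ?B (\<lambda>y. y /\<^sub>R c y)" "(\<lambda>y. y /\<^sub>R c y) ` ?B \<subseteq> D"
    using c_pos u_in D by (force intro: continuous_intros c(1))+
  obtain y v l where y: "y \<in> ?B" and v: "v \<in> cc_envelope T D (y /\<^sub>R c y)"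
    and l: "1 \<le> l" "l = 1 \<or> norm y = 3" and scaled_y: "l *\<^sub>R y = c y *\<^sub>R (v + d y *\<^sub>R w)"
    by (rule cc_envelope_leray_schauder_cone[OF K _ T u c d w]) simp
  have "l *\<^sub>R (y /\<^sub>R c y) = inverse (c y) *\<^sub>R l *\<^sub>R y"
    by (simp add: mult.commute)
  also have "\<dots> = v + d y *\<^sub>R w"
    unfolding scaled_y using c_pos[OF y] by simp
  finally have "l *\<^sub>R (y /\<^sub>R c y) = v + d y *\<^sub>R w" .
  moreover have "norm (y /\<^sub>R c y) = min 1 (norm y) * annulus_radius r1 r2 (norm y)"
    unfolding c_def using y by (intro norm_divide_annulus_scale[OF r]) simp
  ultimately show thesis
    using that[of "norm y" "y /\<^sub>R c y" v l] y v l u_in[OF y] by (simp add: d_def)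
qed

lemma bounded_imp_translate_outside_ball:
  fixes w :: "'a::real_normed_vector"
  assumes "bounded M" "w \<noteq> 0"
  obtains \<Lambda> where "0 \<le> \<Lambda>" "\<And>v. v \<in> M \<Longrightarrow> r < norm (v + \<Lambda> *\<^sub>R w)"
proof -
  obtain b where b: "0 < b" "\<And>v. v \<in> M \<Longrightarrow> norm v \<le> b"
    using assms(1) by (auto simp: bounded_pos)
  define \<Lambda> where "\<Lambda> = (b + \<bar>r\<bar> + 1) / norm w"
  have \<Lambda>: "0 \<le> \<Lambda>" "norm (\<Lambda> *\<^sub>R w) = b + \<bar>r\<bar> + 1"
    using b(1) \<open>w \<noteq> 0\<close> by (auto simp: \<Lambda>_def)
  have "r < norm (v + \<Lambda> *\<^sub>R w)" if "v \<in> M" for v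
    using norm_diff_ineq[of "\<Lambda> *\<^sub>R w" v] b(2)[OF that] \<Lambda>(2) by (simp add: add.commute)
  with \<Lambda>(1) show thesis by (rule that)
qed

theorem cc_envelope_compression_expansion:
  fixes K :: "'a::banach set" and r1 r2 :: real
  assumes K: "closed K" "convex_cone K" and r: "0 < r1" "0 < r2" "r1 \<noteq> r2"
    and D: "K \<inter> cball 0 (max r1 r2) \<subseteq> D"
    and T: "T ` D \<subseteq> K" "compact (closure (T ` D))"
    and compression: "\<And>x l. x \<in> K \<Longrightarrow> norm x = r1 \<Longrightarrow> 1 \<le> l \<Longrightarrow> l *\<^sub>R x \<notin> cc_envelope T D x"
    and w: "w \<in> K" "w \<noteq> 0"
    and expansion: "\<And>x l. x \<in> K \<Longrightarrow> norm x = r2 \<Longrightarrow> 0 \<le> l \<Longrightarrow> x - l *\<^sub>R w \<notin> cc_envelope T D x"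
  obtains x where "x \<in> K" "x \<in> cc_envelope T D x" "min r1 r2 < norm x" "norm x < max r1 r2"
proof -
  have "bounded (closure (convex hull (T ` D)))"
    by (intro compact_imp_bounded compact_closure_convex_hull T(2))
  then obtain \<Lambda> where "0 \<le> \<Lambda>"
    and far: "\<And>v. v \<in> closure (convex hull (T ` D)) \<Longrightarrow> r2 < norm (v + \<Lambda> *\<^sub>R w)"
    using bounded_imp_translate_outside_ball w(2) by blast
  obtain s u v l where s: "0 \<le> s" "s \<le> 3" and u: "u \<in> K" "norm u = min 1 s * annulus_radius r1 r2 s"
    and v: "v \<in> cc_envelope T D u" and l: "1 \<le> l" "l = 1 \<or> s = 3"
    and scaled_u: "l *\<^sub>R u = v + (\<Lambda> * max 0 (min 1 (2 - s))) *\<^sub>R w"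
    by (rule cc_envelope_annulus_fixpoint[OF K r(1,2) D T w(1) \<open>0 \<le> \<Lambda>\<close>])
  have "1 < s"
  proof (rule ccontr)
    assume "\<not> 1 < s"
    then have "u = v + \<Lambda> *\<^sub>R w" "norm u \<le> r2"
      using scaled_u l u(2) s r(2) by (auto simp: annulus_radius_simps mult_left_le_one_le)
    then show False
      using far v cc_envelope_subset by (metis not_less subsetD)
  qed
  then have norm_u: "norm u = annulus_radius r1 r2 s"
    using u(2) by simp
  have "2 < s"
  proof (rule ccontr)
    assume "\<not> 2 < s"
    then have "norm u = r2" "v = u - (\<Lambda> * max 0 (min 1 (2 - s))) *\<^sub>R w"
      using norm_u scaled_u l by (auto simp: annulus_radius_simps)
    then show False
      using expansion u(1) v \<open>0 \<le> \<Lambda>\<close> by simp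
  qed
  then have v_eq: "v = l *\<^sub>R u"
    using scaled_u by simp
  then have "s \<noteq> 3"
    using compression[OF u(1) _ l(1)] v norm_u by (auto simp: annulus_radius_simps)
  with s(2) have "s < 3" by simp
  have "u \<in> cc_envelope T D u"
    using v v_eq l(2) \<open>s \<noteq> 3\<close> by simp
  then show thesis
    using that u(1) norm_u annulus_radius_strict_bounds[OF \<open>2 < s\<close> \<open>s < 3\<close> r(3)] by simp
qed

theorem theorem3:
  fixes K :: "'a::banach set" and T :: "'a \<Rightarrow> 'a" and r1 r2 R :: real
  assumes cone: "is_cone K"
    and pos: "r1 > 0" "r2 > 0" "R > 0"
    and le: "r1 \<le> R" "r2 \<le> R"
    and neq: "r1 \<noteq> r2"
    and maps: "T ` (cball 0 R \<inter> K) \<subseteq> K"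
    and relcpt: "compact (closure (T ` (cball 0 R \<inter> K)))"
    and env: "\<forall>x\<in>cball 0 R \<inter> K. {x} \<inter> cc_envelope T (cball 0 R \<inter> K) x \<subseteq> {T x}"
    and a: "\<forall>x\<in>K. norm x = r1 \<longrightarrow> (\<forall>l::real. l \<ge> 1 \<longrightarrow>
              l *\<^sub>R x \<notin> cc_envelope T (cball 0 R \<inter> K) x)"
    and b: "\<exists>w\<in>K. norm w \<noteq> 0 \<and> (\<forall>l::real. l \<ge> 0 \<longrightarrow> (\<forall>x\<in>K. norm x = r2 \<longrightarrow>
              x \<notin> (\<lambda>y. y + l *\<^sub>R w) ` cc_envelope T (cball 0 R \<inter> K) x))"
  shows "\<exists>x\<in>K. T x = x \<and> min r1 r2 < norm x \<and> norm x < max r1 r2"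
proof -
  define D where "D = cball 0 R \<inter> K"
  obtain w where w: "w \<in> K" "w \<noteq> 0"
    and expansion: "\<And>x l. x \<in> K \<Longrightarrow> norm x = r2 \<Longrightarrow> 0 \<le> l \<Longrightarrow> x - l *\<^sub>R w \<notin> cc_envelope T D x"
    using b unfolding D_def by (force simp: image_iff algebra_simps)
  have K: "closed K" "convex_cone K"
    using cone w(1) by (auto simp: is_cone_def convex_cone_def conic_def)
  have "K \<inter> cball 0 (max r1 r2) \<subseteq> D"
    using le by (auto simp: D_def)
  then obtain x where x: "x \<in> K" "x \<in> cc_envelope T D x" "min r1 r2 < norm x" "norm x < max r1 r2"
    using cc_envelope_compression_expansion[OF K pos(1,2) neq _ maps relcpt _ w] a expansion
    unfolding D_def by blast
  then have "x \<in> D"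
    using le by (auto simp: D_def)
  then have "{x} \<inter> cc_envelope T D x \<subseteq> {T x}"
    using env by (simp add: D_def)
  then have "T x = x"
    using x(2) by auto
  then show ?thesis
    using x by blast
qed

end
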